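(* Let $\mathcal G$ be a generically $d$-rigid graph. Then there is an admissible orientation $\overrightarrow{\mathcal G}$ of $\mathcal G$.
   Context: Fix $d\ge1$ and a finite simple graph $\mathcal G=(\mathcal V,\mathcal E)$ with $\mathcal V=\{1,\dots,n\}$. A configuration is $p=(p_1,\dots,p_n)\in\mathbb R^{dn}$, $p_i\in\mathbb R^d$. Distance map: $F(p)=(\|p_j-p_i\|^2)_{ij\in\mathcal E}$. The rigidity matrix $R(p)\in\mathbb R^{|\mathcal E|\times dn}$ has, in the row of edge $ij$, the block $(p_i-p_j)^\top$ at vertex $i$, $(p_j-p_i)^\top$ at vertex $j$, and zeros elsewhere. $\mathcal G$ is generically $d$-rigid if for generic $p$ every $q$ sufficiently close to $p$ with $F(q)=F(p)$ is congruent to $p$ (differs by a Euclidean isometry). An orientation $\overrightarrow{\mathcal G}$ of $\mathcal G$ chooses for each edge a direction. $\overrightarrow R(p)$ is obtained from $R(p)$ by zeroing out, in the row of each edge, the block of the head: for $\overrightarrow{ij}$ (tail $i$, head $j$) only the block $(p_i-p_j)^\top$ at $i$ is kept. The directed controller $\dot p=-\overrightarrow R(p)^\top(F(p)-m^* )$ has edge operator $Z(p)=2R(p)\overrightarrow R(p)^\top:\mathbb R^{|\mathcal E|}\to\mathbb R^{|\mathcal E|}$, whose image lies in $\operatorname{im}R(p)$ (which, for regular $p$, is the tangent space at $F(p)$ to the manifold $\mathcal Q$ of regular values of $F$). "For every generic $p$" means: for all $p$ outside some proper algebraic subset of $\mathbb R^{dn}$ defined over $\mathbb Q$. The orientation $\overrightarrow{\mathcal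 G}$ is admissible if, for every generic $p$, the restriction $Z(p)|_{\operatorname{im}R(p)}:\operatorname{im}R(p)\to\operatorname{im}R(p)$ is invertible. *)

theory Defs
  imports "HOL-Analysis.Analysis"
begin

text \<open>
  The vertex set is the finite type \<open>'n\<close>, the ambient space is \<open>real ^ 'd\<close>, and configurations have
  type \<open>real ^ 'd ^ 'n\<close>. The space of real vectors indexed by an edge set \<open>E\<close> is embedded into
  \<open>real ^ 'n set\<close> by padding with zeros outside \<open>E\<close>, so that \<open>E\<close> may vary (and be empty); matrices
  with rows indexed by \<open>E\<close> accordingly have zero rows outside \<open>E\<close>.
\<close>

definition simple_graph :: "'n::finite set set \<Rightarrow> bool" where
  "simple_graph E \<longleftrightarrow> (\<forall>e\<in>E. card e = 2)"


subsection \<open>Genericity\<close>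

inductive rat_polynomial_function :: "(real ^ 'd::finite ^ 'n::finite \<Rightarrow> real) \<Rightarrow> bool" where
  const: "c \<in> \<rat> \<Longrightarrow> rat_polynomial_function (\<lambda>p. c)"
| coord: "rat_polynomial_function (\<lambda>p. p $ i $ k)"
| add: "rat_polynomial_function f \<Longrightarrow> rat_polynomial_function g \<Longrightarrow> rat_polynomial_function (\<lambda>p. f p + g p)"
| mult: "rat_polynomial_function f \<Longrightarrow> rat_polynomial_function g \<Longrightarrow> rat_polynomial_function (\<lambda>p. f p * g p)"

definition algebraic_over_rat :: "(real ^ 'd::finite ^ 'n::finite) set \<Rightarrow> bool" where
  "algebraic_over_rat A \<longleftrightarrow>
     (\<exists>S. (\<forall>f\<in>S. rat_polynomial_function f) \<and> A = {p. \<forall>f\<in>S. f p = 0})"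

definition for_generic :: "(real ^ 'd::finite ^ 'n::finite \<Rightarrow> bool) \<Rightarrow> bool" where
  "for_generic P \<longleftrightarrow> (\<exists>A. algebraic_over_rat A \<and> A \<noteq> UNIV \<and> (\<forall>p. p \<notin> A \<longrightarrow> P p))"


subsection \<open>Rigidity\<close>

definition distance_map :: "'n set set \<Rightarrow> real ^ 'd ^ 'n \<Rightarrow> real ^ ('n::finite set)" where
  "distance_map E p =
     (\<chi> e. if e \<in> E then (THE r. \<exists>i j. e = {i, j} \<and> r = (norm (p $ j - p $ i))\<^sup>2) else 0)"

definition congruent_config :: "real ^ 'd::finite ^ 'n::finite \<Rightarrow> real ^ 'd ^ 'n \<Rightarrow> bool" where
  "congruent_config p q \<longleftrightarrow>
     (\<exists>T :: real ^ 'd \<Rightarrow> real ^ 'd. (\<forall>x y. dist (T x) (T y) = dist x y) \<and> (\<forall>i. q $ i = T (p $ i)))"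

definition generically_rigid :: "'d::finite itself \<Rightarrow> 'n::finite set set \<Rightarrow> bool" where
  "generically_rigid d E \<longleftrightarrow>
     for_generic (\<lambda>p :: real ^ 'd ^ 'n.
       \<forall>\<^sub>F q in nhds p. distance_map E q = distance_map E p \<longrightarrow> congruent_config p q)"

definition other_end :: "'n set \<Rightarrow> 'n \<Rightarrow> 'n" where
  "other_end e i = the_elem (e - {i})"

definition rigidity_matrix ::
    "'n set set \<Rightarrow> real ^ 'd ^ 'n \<Rightarrow> real ^ ('n::finite \<times> 'd::finite) ^ ('n set)" where
  "rigidity_matrix E p =
     (\<chi> e. vec_lambda (\<lambda>(i, k). if e \<in> E \<and> i \<in> e then (p $ i - p $ other_end e i) $ k else 0))"


subsection \<open>Orientations\<close>

text \<open>An orientation is given by its set of arcs \<open>(tail, head)\<close>.\<close>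

definition is_orientation :: "'n::finite set set \<Rightarrow> ('n \<times> 'n) set \<Rightarrow> bool" where
  "is_orientation E A \<longleftrightarrow>
     (\<forall>(i, j)\<in>A. {i, j} \<in> E) \<and>
     (\<forall>i j. {i, j} \<in> E \<longrightarrow> ((i, j) \<in> A \<longleftrightarrow> (j, i) \<notin> A))"

definition directed_rigidity_matrix ::
    "'n set set \<Rightarrow> ('n \<times> 'n) set \<Rightarrow> real ^ 'd ^ 'n \<Rightarrow> real ^ ('n::finite \<times> 'd::finite) ^ ('n set)" where
  "directed_rigidity_matrix E A p =
     (\<chi> e. vec_lambda (\<lambda>(i, k). if \<exists>j. (j, i) \<in> A \<and> e = {j, i} then 0 else rigidity_matrix E p $ e $ (i, k)))"

definition edge_operator ::
    "'n set set \<Rightarrow> ('n \<times> 'n) set \<Rightarrow> real ^ 'd::finite ^ 'n \<Rightarrow> real ^ ('n::finite set) ^ ('n set)" where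
  "edge_operator E A p =
     2 *\<^sub>R (rigidity_matrix E p ** transpose (directed_rigidity_matrix E A p))"

definition admissible :: "'d::finite itself \<Rightarrow> 'n::finite set set \<Rightarrow> ('n \<times> 'n) set \<Rightarrow> bool" where
  "admissible d E A \<longleftrightarrow>
     for_generic (\<lambda>p :: real ^ 'd ^ 'n.
       bij_betw ((*v) (edge_operator E A p))
         (range ((*v) (rigidity_matrix E p))) (range ((*v) (rigidity_matrix E p))))"


subsection \<open>Explicit entries\<close>

lemma distance_map_edge:
  assumes "{i, j} \<in> E"
  shows "distance_map E p $ {i, j} = (norm (p $ j - p $ i))\<^sup>2"
proof -
  have "(THE r. \<exists>i' j'. {i, j} = {i', j'} \<and> r = (norm (p $ j' - p $ i'))\<^sup>2) = (norm (p $ j - p $ i))\<^sup>2"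
    by (rule the_equality) (auto simp: doubleton_eq_iff norm_minus_commute)
  with assms show ?thesis
    by (simp add: distance_map_def)
qed

lemma other_end_doubleton: "i \<noteq> j \<Longrightarrow> other_end {i, j} i = j" "i \<noteq> j \<Longrightarrow> other_end {i, j} j = i"
  by (simp_all add: other_end_def insert_Diff_if)

lemma rigidity_matrix_edge:
  assumes "{i, j} \<in> E" "i \<noteq> j"
  shows "rigidity_matrix E p $ {i, j} $ (l, k) =
           (if l = i then (p $ i - p $ j) $ k else if l = j then (p $ j - p $ i) $ k else 0)"
  using assms by (auto simp: rigidity_matrix_def other_end_doubleton)

lemma directed_rigidity_matrix_edge:
  assumes "is_orientation E A" "(i, j) \<in> A" "i \<noteq> j"
  shows "directed_rigidity_matrix E A p $ {i, j} $ (l, k) =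
           (if l = i then (p $ i - p $ j) $ k else 0)"
proof -
  have "{i, j} \<in> E" "(j, i) \<notin> A"
    using assms by (auto simp: is_orientation_def)
  with assms show ?thesis
    by (auto simp: directed_rigidity_matrix_def rigidity_matrix_edge doubleton_eq_iff)
qed

end

theory Submission
  imports Defs
begin

text \<open>
  Why some orientation is admissible. Write \<open>R\<close> for the rigidity matrix, \<open>D\<close> for the directed one, and
  \<open>Z = 2 R D\<^sup>T\<close>. Each row of \<open>R\<close> is the sum of its two endpoint blocks, and an orientation keeps one
  of them. A uniformly random orientation therefore has \<open>R / 2\<close> as the mean of \<open>D\<close>, and since a determinant
  is affine in each row separately, the mean of \<open>det Z\<close> over all orientations is the determinant of the
  mean operator \<open>R R\<^sup>T\<close>. This operator is positive definite on the image of \<open>R\<close>, so not all orientations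
  can give \<open>0\<close>.

  The determinant meant here is that of the restriction to the image \<open>W\<close> of \<open>R\<close>. To stay with
  full square matrices, a symmetric matrix \<open>P\<close> is added that vanishes on \<open>W\<close> and acts
  injectively on the orthogonal complement (\<open>exists_symmetric_matrix_with_kernel\<close>); then
  \<open>2 (R R\<^sup>T + P)\<close> is invertible, and \<open>det_row_selection\<close> finds an orientation for which \<open>Z\<^sup>T + P\<close> is
  invertible, hence \<open>Z\<close> is injective on \<open>W\<close> (\<open>exists_injective_orientation\<close>).

  This is done at one configuration \<open>p0\<close>, chosen so that \<open>R\<close> has the largest possible rank there. For
  the orientation found, \<open>Z R\<close> has at \<open>p0\<close> the same rank as \<open>R\<close>. The entries of \<open>Z R\<close> are polynomials over
  the rationals, so for generic \<open>p\<close> the rank of \<open>Z R\<close> is at least its rank at \<open>p0\<close>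
  (\<open>rank_lower_semicontinuous_generic\<close>). By the choice of \<open>p0\<close> it is then at least
  the rank of \<open>R\<close> at \<open>p\<close>, which forces \<open>Z\<close> to map the image of \<open>R\<close> bijectively onto itself
  (\<open>bij_betw_subspace\<close>).
\<close>


section \<open>Rational polynomial functions and generic rank\<close>

lemma rat_polynomial_function_sum:
  assumes "\<And>i. i \<in> I \<Longrightarrow> rat_polynomial_function (f i)"
  shows "rat_polynomial_function (\<lambda>p. \<Sum>i\<in>I. f i p)"
  using assms
  by (induction I rule: infinite_finite_induct)
    (auto intro: rat_polynomial_function.intros)

lemma rat_polynomial_function_prod:
  assumes "\<And>i. i \<in> I \<Longrightarrow> rat_polynomial_function (f i)"
  shows "rat_polynomial_function (\<lambda>p. \<Prod>i\<in>I. f i p)"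
  using assms
  by (induction I rule: infinite_finite_induct)
    (auto intro: rat_polynomial_function.intros)

lemma rat_polynomial_function_diff:
  assumes "rat_polynomial_function f" "rat_polynomial_function g"
  shows "rat_polynomial_function (\<lambda>p. f p - g p)"
proof -
  have "rat_polynomial_function (\<lambda>p. f p + (-1) * g p)"
    using assms by (intro rat_polynomial_function.intros) auto
  then show ?thesis
    by simp
qed

lemma rat_polynomial_function_det:
  assumes "\<And>i j. rat_polynomial_function (\<lambda>p. M p $ i $ j)"
  shows "rat_polynomial_function (\<lambda>p. det (M p))"
  unfolding det_def
  by (intro rat_polynomial_function_sum rat_polynomial_function.mult rat_polynomial_function_prod
      rat_polynomial_function.const assms) simp

lemma rat_polynomial_function_matrix_mult:
  assumes "\<And>i j. rat_polynomial_function (\<lambda>p. M p $ i $ j)"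
    and "\<And>i j. rat_polynomial_function (\<lambda>p. N p $ i $ j)"
  shows "rat_polynomial_function (\<lambda>p. (M p ** N p) $ i $ j)"
  unfolding matrix_matrix_mult_def
  by (simp add: rat_polynomial_function_sum rat_polynomial_function.mult assms)

lemma for_generic_mono: "for_generic P \<Longrightarrow> (\<And>p. P p \<Longrightarrow> Q p) \<Longrightarrow> for_generic Q"
  unfolding for_generic_def by blast

lemma for_generic_nonzero:
  assumes "rat_polynomial_function f" "f p0 \<noteq> 0" and "\<And>p. f p \<noteq> 0 \<Longrightarrow> P p"
  shows "for_generic P"
  unfolding for_generic_def
proof (intro exI conjI allI impI)
  show "algebraic_over_rat {p. f p = 0}"
    unfolding algebraic_over_rat_def using assms(1) by (intro exI[of _ "{f}"]) auto
  show "{p. f p = 0} \<noteq> UNIV" using assms(2) by auto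
  show "P p" if "p \<notin> {p. f p = 0}" for p using that assms(3) by auto
qed

text \<open>
  A maximal independent set of columns at \<open>p0\<close> is completed by coordinate vectors to a basis of the
  whole space. Letting \<open>p\<close> vary in these columns while keeping the coordinate vectors
  fixed gives a square matrix of rational polynomials. Wherever its determinant is nonzero, the chosen columns
  are still independent. Completing by coordinate vectors rather than arbitrary ones is what
  keeps the determinant a polynomial over the rationals.
\<close>
lemma rank_lower_semicontinuous_generic:
  fixes M :: "real ^ 'd::finite ^ 'n::finite \<Rightarrow> real ^ 'c::finite ^ 'm::finite"
  assumes poly: "\<And>i j. rat_polynomial_function (\<lambda>p. M p $ i $ j)"
  shows "for_generic (\<lambda>p. rank (M p0) \<le> rank (M p))"
proof -
  obtain B where B: "B \<subseteq> columns (M p0)" "independent B" "columns (M p0) \<subseteq> span B"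
      "card B = dim (columns (M p0))"
    by (rule basis_exists)
  obtain B' where B': "B \<subseteq> B'" "B' \<subseteq> B \<union> Basis" "independent B'" "B \<union> Basis \<subseteq> span B'"
    using maximal_independent_subset_extend[of B "B \<union> Basis"] B by (metis Un_upper1)
  have span: "span B' = UNIV"
    using B'(4) by (metis Un_upper2 order_trans span_Basis span_mono span_span top.extremum_uniqueI)
  have fin: "finite B'"
    using B'(3) by (simp add: independent_imp_finite)
  have "card B' = CARD('m)"
    using dim_span_eq_card_independent[OF B'(3)] span by simp
  then obtain b :: "'m \<Rightarrow> real ^ 'm" where b: "bij_betw b UNIV B'"
    using fin finite_same_card_bij[of "UNIV :: 'm set" B'] by auto
  define J where "J = {j. b j \<in> B}"
  have "bij_betw b J B"
    using b B'(1) unfolding J_def bij_betw_def by (auto simp: inj_on_def)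
  then have cardJ: "card J = rank (M p0)"
    using B(4) by (simp add: bij_betw_same_card column_rank_def)
  have "\<exists>c. \<forall>j\<in>J. b j = column (c j) (M p0)"
    using B(1) unfolding J_def columns_def by (intro bchoice) blast
  then obtain c where c: "\<And>j. j \<in> J \<Longrightarrow> b j = column (c j) (M p0)" by blast
  have "\<exists>k. b j = axis k 1" if "j \<notin> J" for j
    using that b B'(2) unfolding J_def bij_betw_def Basis_vec_def by auto
  then obtain a where a: "\<And>j. j \<notin> J \<Longrightarrow> b j = axis (a j) 1" by metis
  \<comment> \<open>the columns of \<open>D p0\<close> are the basis \<open>b\<close>; only those indexed by \<open>J\<close> move with \<open>p\<close>\<close>
  define D where "D = (\<lambda>p. (\<chi> i j. if j \<in> J then M p $ i $ c j else axis (a j) 1 $ i) :: real ^ 'm ^ 'm)"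
  have col: "column j (D p) = (if j \<in> J then column (c j) (M p) else axis (a j) 1)" for j p
    by (simp add: D_def column_def vec_eq_iff)
  show ?thesis
  proof (rule for_generic_nonzero)
    show "rat_polynomial_function (\<lambda>p. det (D p))"
    proof (rule rat_polynomial_function_det)
      show "rat_polynomial_function (\<lambda>p. D p $ i $ j)" for i j
        by (cases "j \<in> J") (auto simp: D_def poly axis_def intro: rat_polynomial_function.const)
    qed
    have "columns (D p0) = B'"
      using b c a unfolding columns_def col bij_betw_def by (auto simp: image_def) metis+
    then show "det (D p0) \<noteq> 0"
      using span dim_eq_full[of B'] by (simp add: det_eq_0_rank column_rank_def)
    fix p assume "det (D p) \<noteq> 0"
    then have "CARD('m) \<le> rank (D p)"
      by (simp add: det_eq_0_rank)
    also have "\<dots> = dim (columns (D p))"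
      by (simp add: column_rank_def)
    also have "\<dots> \<le> rank (M p) + card (- J)"
    proof -
      obtain C where C: "C \<subseteq> columns (M p)" "independent C" "columns (M p) \<subseteq> span C"
          "card C = dim (columns (M p))"
        by (rule basis_exists)
      let ?K = "(\<lambda>j. axis (a j) 1 :: real ^ 'm) ` (- J)"
      have "columns (D p) \<subseteq> span (C \<union> ?K)"
      proof
        fix x assume "x \<in> columns (D p)"
        then obtain j where "x = column j (D p)" by (auto simp: columns_def)
        then show "x \<in> span (C \<union> ?K)"
          using C(3) span_mono[of C "C \<union> ?K"]
          by (auto simp: col columns_def intro: span_base split: if_splits)
      qed
      then have "dim (columns (D p)) \<le> card (C \<union> ?K)"
        using C(2) by (intro dim_le_card) (auto intro: independent_imp_finite)
      also have "\<dots> \<le> card C + card ?K"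
        by (rule card_Un_le)
      also have "\<dots> \<le> rank (M p) + card (- J)"
        using C(4) by (simp add: column_rank_def card_image_le)
      finally show ?thesis .
    qed
    finally show "rank (M p0) \<le> rank (M p)"
      using cardJ card_mono[of UNIV J] by (simp add: Compl_eq_Diff_UNIV card_Diff_subset)
  qed
qed


section \<open>Linear algebra\<close>

text \<open>
  By multilinearity the determinant with rows \<open>a e + b e\<close> is the sum of the determinants of all
  selections. The proof splits one row at a time and keeps a summand that does not vanish.
\<close>
lemma det_row_selection:
  fixes a b :: "'m::finite \<Rightarrow> real ^ 'm"
  assumes "det (\<chi> e. a e + b e) \<noteq> 0"
  shows "\<exists>T. det (\<chi> e. if e \<in> T then a e else b e) \<noteq> 0"
proof -
  have "\<exists>T. det (\<chi> e. if e \<in> S then if e \<in> T then a e else b e else a e + b e) \<noteq> 0" for S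
  proof (induction S rule: infinite_finite_induct)
    case (insert k S)
    then obtain T where T: "det (\<chi> e. if e \<in> S then if e \<in> T then a e else b e else a e + b e) \<noteq> 0"
      by blast
    define c where "c = (\<lambda>e. if e \<in> S then if e \<in> T then a e else b e else a e + b e)"
    have "(\<chi> e. c e) = (\<chi> e. if e = k then a e + b e else c e)"
      using insert.hyps by (simp add: c_def vec_eq_iff)
    then have "det (\<chi> e. if e = k then a e else c e) + det (\<chi> e. if e = k then b e else c e) \<noteq> 0"
      using T det_row_add[of k a b c] unfolding c_def[symmetric] by simp
    then consider "det (\<chi> e. if e = k then a e else c e) \<noteq> 0" | "det (\<chi> e. if e = k then b e else c e) \<noteq> 0"
      by force
    then show ?case
    proof cases
      case 1
      have "(\<chi> e. if e = k then a e else c e) =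
          (\<chi> e. if e \<in> insert k S then if e \<in> insert k T then a e else b e else a e + b e)"
        using insert.hyps by (auto simp: c_def vec_eq_iff)
      from 1[unfolded this] show ?thesis by (rule exI)
    next
      case 2
      have "(\<chi> e. if e = k then b e else c e) =
          (\<chi> e. if e \<in> insert k S then if e \<in> T - {k} then a e else b e else a e + b e)"
        using insert.hyps by (auto simp: c_def vec_eq_iff)
      from 2[unfolded this] show ?thesis by (rule exI)
    qed
  qed (use assms in auto)
  from this[of UNIV] show ?thesis by simp
qed

lemma bij_betw_subspace:
  fixes f :: "'a::euclidean_space \<Rightarrow> 'a"
  assumes "linear f" "subspace V" "f ` V \<subseteq> V" "dim V \<le> dim (f ` V)"
  shows "bij_betw f V V"
proof -
  have img: "f ` V = V"
    using assms by (intro subspace_dim_equal linear_subspace_image) auto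
  obtain B where B: "B \<subseteq> V" "independent B" "V \<subseteq> span B" "card B = dim V"
    by (rule basis_exists)
  have V: "V = span B"
    using B assms(2) by (simp add: span_minimal subset_antisym)
  have fin: "finite B"
    using B(2) by (rule independent_imp_finite)
  have spanV: "V = span (f ` B)"
    using img V assms(1) by (metis linear_span_image)
  have "card (f ` B) \<le> dim V"
    using fin B(4) by (metis card_image_le)
  then have "independent (f ` B)"
    using fin spanV B(1) img by (intro card_le_dim_spanning[of _ V]) auto
  moreover have "card (f ` B) = card B"
    using \<open>independent (f ` B)\<close> spanV B(4) dim_span_eq_card_independent by metis
  then have "inj_on f B"
    using fin by (simp add: eq_card_imp_inj_on)
  ultimately have "inj_on f V"
    unfolding V using assms(1) linear_inj_on_span_independent_image by blast
  with img show ?thesis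
    by (simp add: bij_betw_def)
qed

text \<open>
  The orthogonal projection onto the complement of \<open>W\<close> has these properties. The sum of \<open>b b\<^sup>T\<close> over any
  basis of that complement has them too, and needs no orthonormalisation: its quadratic form
  is the sum of the squares of the inner products with the \<open>b\<close>.
\<close>
lemma exists_symmetric_matrix_with_kernel:
  fixes W :: "(real ^ 'm::finite) set"
  obtains P :: "real ^ 'm ^ 'm" where "\<And>w. w \<in> W \<Longrightarrow> P *v w = 0"
    "\<And>x w. w \<in> W \<Longrightarrow> inner w (P *v x) = 0" "transpose P = P"
    "\<And>x. (\<And>w. w \<in> W \<Longrightarrow> inner w x = 0) \<Longrightarrow> P *v x = 0 \<Longrightarrow> x = 0"
proof -
  let ?U = "{x. \<forall>w\<in>W. inner w x = 0}"
  obtain B where B: "B \<subseteq> ?U" "independent B" "?U \<subseteq> span B"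
    by (rule basis_exists[of ?U])
  define P :: "real ^ 'm ^ 'm" where "P = (\<chi> i j. \<Sum>b\<in>B. b $ i * b $ j)"
  have P: "P *v x = (\<Sum>b\<in>B. inner b x *\<^sub>R b)" for x
  proof -
    have "(P *v x) $ i = (\<Sum>b\<in>B. inner b x *\<^sub>R b) $ i" for i
    proof -
      have "(P *v x) $ i = (\<Sum>j\<in>UNIV. \<Sum>b\<in>B. b $ i * b $ j * x $ j)"
        by (simp add: P_def matrix_vector_mult_def sum_distrib_right)
      also have "\<dots> = (\<Sum>b\<in>B. \<Sum>j\<in>UNIV. b $ i * b $ j * x $ j)"
        by (rule sum.swap)
      finally show ?thesis
        by (simp add: inner_vec_def sum_distrib_left sum_distrib_right mult_ac)
    qed
    then show ?thesis
      by (simp add: vec_eq_iff)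
  qed
  show ?thesis
  proof
    show "P *v w = 0" if "w \<in> W" for w
      using B(1) that by (auto simp: P inner_commute intro!: sum.neutral)
    show "inner w (P *v x) = 0" if "w \<in> W" for x w
      using B(1) that by (auto simp: P inner_sum_right intro!: sum.neutral)
    show "transpose P = P"
      by (simp add: P_def transpose_def vec_eq_iff mult.commute)
    fix x assume x: "\<And>w. w \<in> W \<Longrightarrow> inner w x = 0" and Px: "P *v x = 0"
    have "0 = inner (P *v x) x" using Px by simp
    also have "\<dots> = (\<Sum>b\<in>B. (inner b x)\<^sup>2)"
      by (simp add: P inner_sum_left power2_eq_square)
    finally have "\<forall>b\<in>B. inner b x = 0"
      using B(2) by (simp add: sum_nonneg_eq_0_iff independent_imp_finite)
    moreover have "x \<in> span B" using x B(3) by auto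
    ultimately have "orthogonal x x"
      by (intro orthogonal_to_span[of x B x]) (auto simp: orthogonal_def inner_commute)
    then show "x = 0" by (simp add: orthogonal_def)
  qed
qed



section \<open>An orientation that works at a given configuration\<close>

definition arcs_from_tails :: "'n set set \<Rightarrow> ('n set \<Rightarrow> 'n) \<Rightarrow> ('n \<times> 'n) set" where
  "arcs_from_tails E \<tau> = {(i, j). {i, j} \<in> E \<and> \<tau> {i, j} = i}"

lemma is_orientation_arcs_from_tails:
  fixes E :: "'n::finite set set"
  assumes "simple_graph E" "\<And>e. e \<in> E \<Longrightarrow> \<tau> e \<in> e"
  shows "is_orientation E (arcs_from_tails E \<tau>)"
  unfolding is_orientation_def
proof (intro conjI allI impI)
  show "\<forall>(i, j)\<in>arcs_from_tails E \<tau>. {i, j} \<in> E"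
    by (auto simp: arcs_from_tails_def)
  fix i j assume e: "{i, j} \<in> E"
  then have "card {i, j} = 2"
    using assms(1) unfolding simple_graph_def by blast
  then have "i \<noteq> j"
    by auto
  with e assms(2)[OF e] show "((i, j) \<in> arcs_from_tails E \<tau>) = ((j, i) \<notin> arcs_from_tails E \<tau>)"
    by (auto simp: arcs_from_tails_def insert_commute)
qed

definition end_block :: "real ^ 'd ^ 'n \<Rightarrow> 'n set \<Rightarrow> 'n \<Rightarrow> real ^ ('n::finite \<times> 'd::finite)" where
  "end_block p e i = vec_lambda (\<lambda>(l, k). if l = i then (p $ i - p $ other_end e i) $ k else 0)"

lemma rigidity_matrix_row:
  assumes "{i, j} \<in> E" "i \<noteq> j"
  shows "rigidity_matrix E p $ {i, j} = end_block p {i, j} i + end_block p {i, j} j"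
  using assms
  by (auto simp: vec_eq_iff rigidity_matrix_edge end_block_def other_end_doubleton)

lemma directed_rigidity_matrix_row:
  assumes "simple_graph E" "\<And>e. e \<in> E \<Longrightarrow> \<tau> e \<in> e" "e \<in> E"
  shows "directed_rigidity_matrix E (arcs_from_tails E \<tau>) p $ e = end_block p e (\<tau> e)"
proof -
  obtain i j where ij: "e = {i, j}" "i \<noteq> j" "\<tau> e = i"
    using assms unfolding simple_graph_def
    by (metis card_2_iff doubleton_eq_iff insertE singletonD)
  with assms(3) have "(i, j) \<in> arcs_from_tails E \<tau>"
    by (auto simp: arcs_from_tails_def)
  with is_orientation_arcs_from_tails[OF assms(1,2)] ij show ?thesis
    by (auto simp: vec_eq_iff directed_rigidity_matrix_edge end_block_def other_end_doubleton)
qed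

lemma directed_rigidity_matrix_off_graph:
  "e \<notin> E \<Longrightarrow> directed_rigidity_matrix E A p $ e = 0"
  by (auto simp: vec_eq_iff directed_rigidity_matrix_def rigidity_matrix_def)

lemma matrix_mult_transpose_row:
  fixes A :: "real ^ 'k::finite ^ 'm::finite" and B :: "real ^ 'k ^ 'l::finite"
  shows "(A ** transpose B) $ e = B *v (A $ e)"
  by (simp add: vec_eq_iff matrix_matrix_mult_def matrix_vector_mult_def transpose_def mult.commute)

text \<open>
  Halving would give the mean over all orientations; doubling the mean operator instead makes row \<open>e\<close>
  of \<open>2 (R R\<^sup>T + P)\<close> the plain sum of the rows that \<open>Z\<^sup>T + P\<close> has for the two directions of \<open>e\<close>.
  A selection of summands is then the same thing as a choice of tails.
\<close>
lemma exists_injective_orientation: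
  fixes E :: "'n::finite set set" and p :: "real ^ 'd::finite ^ 'n"
  assumes "simple_graph E"
  shows "\<exists>A. is_orientation E A \<and>
    inj_on ((*v) (edge_operator E A p)) (range ((*v) (rigidity_matrix E p)))"
proof -
  let ?R = "rigidity_matrix E p"
  let ?W = "range ((*v) ?R)"
  obtain P :: "real ^ 'n set ^ 'n set" where P: "\<And>w. w \<in> ?W \<Longrightarrow> P *v w = 0"
    "\<And>x w. w \<in> ?W \<Longrightarrow> inner w (P *v x) = 0" "transpose P = P"
    "\<And>x. (\<And>w. w \<in> ?W \<Longrightarrow> inner w x = 0) \<Longrightarrow> P *v x = 0 \<Longrightarrow> x = 0"
    by (rule exists_symmetric_matrix_with_kernel[of ?W]) blast
  have "\<exists>i j. e = {i, j} \<and> i \<noteq> j" if "e \<in> E" for e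
    using that assms unfolding simple_graph_def by (meson card_2_iff)
  then obtain s t where st: "\<And>e. e \<in> E \<Longrightarrow> e = {s e, t e} \<and> s e \<noteq> t e"
    by metis
  \<comment> \<open>\<open>pick r e\<close> is row \<open>e\<close> of \<open>Z\<^sup>T + P\<close> when the tail of \<open>e\<close> is \<open>r e\<close>\<close>
  define pick where "pick = (\<lambda>r e. 2 *\<^sub>R (?R *v (if e \<in> E then end_block p e (r e) else 0)) + P $ e)"
  have row: "(2 *\<^sub>R (?R ** transpose ?R + P)) $ e = pick s e + pick t e" for e
  proof -
    have "?R $ e = (if e \<in> E then end_block p e (s e) else 0) + (if e \<in> E then end_block p e (t e) else 0)"
    proof (cases "e \<in> E")
      case True
      then show ?thesis using st[OF True] rigidity_matrix_row[of "s e" "t e" E p] by simp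
    next
      case False
      then show ?thesis by (auto simp: vec_eq_iff rigidity_matrix_def)
    qed
    then show ?thesis
      unfolding pick_def
      by (simp add: matrix_mult_transpose_row matrix_vector_right_distrib scaleR_right_distrib scaleR_2)
  qed
  \<comment> \<open>\<open>R R\<^sup>T x\<close> and \<open>P x\<close> are orthogonal, so both vanish if their sum does\<close>
  have "x = 0" if "(2 *\<^sub>R (?R ** transpose ?R + P)) *v x = 0" for x
  proof -
    let ?y = "transpose ?R *v x"
    have sum0: "?R *v ?y + P *v x = 0"
      using that
      by (simp add: matrix_vector_mult_add_rdistrib matrix_vector_mul_assoc
          del: transpose_matrix_vector flip: scaleR_matrix_vector_assoc)
    have "inner (?R *v ?y) (?R *v ?y) = inner (?R *v ?y) (?R *v ?y + P *v x)"
      unfolding inner_add_right using P(2)[OF rangeI, of ?y x] by simp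
    then have Ry: "?R *v ?y = 0"
      unfolding sum0 by simp
    have adj: "inner (?R *v z) x = inner z ?y" for z
      using dot_lmul_matrix[of x ?R z] by (simp add: inner_commute)
    have "inner ?y ?y = 0"
      unfolding adj[symmetric] Ry by simp
    then have "inner w x = 0" if "w \<in> ?W" for w
      using that by (auto simp: adj simp del: transpose_matrix_vector)
    moreover have "P *v x = 0"
      using sum0 unfolding Ry by simp
    ultimately show "x = 0"
      by (rule P(4))
  qed
  then have "det (2 *\<^sub>R (?R ** transpose ?R + P)) \<noteq> 0"
    by (metis det_eq_0_rank matrix_nonfull_linear_equations_eq less_irrefl)
  moreover have "2 *\<^sub>R (?R ** transpose ?R + P) = (\<chi> e. pick s e + pick t e)"
    using row by (simp add: vec_eq_iff)
  ultimately obtain T where T: "det (\<chi> e. if e \<in> T then pick s e else pick t e) \<noteq> 0"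
    using det_row_selection[of "pick s" "pick t"] by auto
  define \<tau> where "\<tau> = (\<lambda>e. if e \<in> T then s e else t e)"
  have \<tau>: "\<tau> e \<in> e" if "e \<in> E" for e
    using st[OF that] unfolding \<tau>_def by (metis insertCI)
  define A where "A = arcs_from_tails E \<tau>"
  have "transpose (edge_operator E A p) + P = (\<chi> e. if e \<in> T then pick s e else pick t e)"
  proof -
    have "2 *\<^sub>R ((directed_rigidity_matrix E A p ** transpose ?R) $ e) + P $ e = pick \<tau> e" for e
      unfolding pick_def matrix_mult_transpose_row A_def
      by (simp add: directed_rigidity_matrix_row[OF assms \<tau>] directed_rigidity_matrix_off_graph)
    moreover have "pick \<tau> e = (if e \<in> T then pick s e else pick t e)" for e
      by (simp add: pick_def \<tau>_def)
    moreover have "transpose (edge_operator E A p) = 2 *\<^sub>R (directed_rigidity_matrix E A p ** transpose ?R)"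
      by (simp add: edge_operator_def transpose_scalar matrix_transpose_mul)
    ultimately show ?thesis by (simp add: vec_eq_iff)
  qed
  then have "det (transpose (edge_operator E A p) + P) \<noteq> 0"
    using T by simp
  moreover have "transpose (edge_operator E A p + P) = transpose (edge_operator E A p) + P"
    using P(3) by (simp add: transpose_def vec_eq_iff)
  ultimately have "det (edge_operator E A p + P) \<noteq> 0"
    by (metis det_transpose)
  then have "inj ((*v) (edge_operator E A p + P))"
    unfolding det_eq_0_rank less_rank_noninjective by blast
  then have "inj_on ((*v) (edge_operator E A p + P)) ?W"
    by (rule inj_on_subset) simp
  then have "inj_on ((*v) (edge_operator E A p)) ?W"
    by (rule inj_on_cong[THEN iffD1, rotated]) (simp add: P(1) matrix_vector_mult_add_rdistrib)
  then show ?thesis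
    using is_orientation_arcs_from_tails[OF assms \<tau>] unfolding A_def by blast
qed


section \<open>Passing to generic configurations\<close>

lemma rat_polynomial_function_rigidity_matrix:
  "rat_polynomial_function (\<lambda>p. rigidity_matrix E p $ e $ x)"
proof (cases x)
  case (Pair i k)
  then show ?thesis
    by (cases "e \<in> E \<and> i \<in> e")
      (simp_all only: rigidity_matrix_def vec_lambda_beta prod.case simp_thms if_True if_False vector_minus_component
        rat_polynomial_function_diff rat_polynomial_function.coord rat_polynomial_function.const Rats_0)
qed

lemma rat_polynomial_function_directed_rigidity_matrix:
  "rat_polynomial_function (\<lambda>p. directed_rigidity_matrix E A p $ e $ x)"
proof (cases x)
  case (Pair i k)
  then show ?thesis
    by (cases "\<exists>j. (j, i) \<in> A \<and> e = {j, i}")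
      (simp_all only: directed_rigidity_matrix_def vec_lambda_beta prod.case if_True if_False
        rat_polynomial_function_rigidity_matrix rat_polynomial_function.const Rats_0)
qed

lemma rat_polynomial_function_edge_operator:
  "rat_polynomial_function (\<lambda>p. edge_operator E A p $ e $ e')"
proof -
  have "rat_polynomial_function
      (\<lambda>p. (rigidity_matrix E p ** transpose (directed_rigidity_matrix E A p)) $ e $ e')"
    by (intro rat_polynomial_function_matrix_mult rat_polynomial_function_rigidity_matrix)
      (simp add: transpose_def rat_polynomial_function_directed_rigidity_matrix)
  then have "rat_polynomial_function
      (\<lambda>p. 2 * (rigidity_matrix E p ** transpose (directed_rigidity_matrix E A p)) $ e $ e')"
    by (intro rat_polynomial_function.mult rat_polynomial_function.const) auto
  then show ?thesis
    by (simp add: edge_operator_def)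
qed

theorem mainTheorem4:
  fixes E :: "'n::finite set set"
  assumes "simple_graph E"
    and "generically_rigid TYPE('d::finite) E"
  shows "\<exists>A. is_orientation E A \<and> admissible TYPE('d) E A"
proof -
  let ?R = "rigidity_matrix E :: real ^ 'd ^ 'n \<Rightarrow> _"
  have "\<exists>p0. \<forall>p. rank (?R p) \<le> rank (?R p0)"
    using ex_has_greatest_nat[of "\<lambda>_. True" _ "\<lambda>p. rank (?R p)" "Suc CARD('n set)"]
    by (metis le_imp_less_Suc min.boundedE rank_bound)
  then obtain p0 where p0: "\<And>p. rank (?R p) \<le> rank (?R p0)"
    by blast
  obtain A where A: "is_orientation E A"
    "inj_on ((*v) (edge_operator E A p0)) (range ((*v) (?R p0)))"
    using exists_injective_orientation[OF assms(1)] by blast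
  have rank_mult: "rank (edge_operator E A p ** ?R p) =
      dim ((*v) (edge_operator E A p) ` range ((*v) (?R p)))" for p
    by (simp add: rank_dim_range image_image matrix_vector_mul_assoc)
  have sub: "subspace (range ((*v) (?R p)))" for p
    by (intro linear_subspace_image) auto
  have "rank (edge_operator E A p0 ** ?R p0) = rank (?R p0)"
    unfolding rank_mult using A(2) sub[of p0]
    by (subst dim_image_eq) (auto simp: rank_dim_range span_eq_iff[THEN iffD2])
  moreover have "for_generic (\<lambda>p. rank (edge_operator E A p0 ** ?R p0) \<le> rank (edge_operator E A p ** ?R p))"
    by (intro rank_lower_semicontinuous_generic rat_polynomial_function_matrix_mult
        rat_polynomial_function_edge_operator rat_polynomial_function_rigidity_matrix)
  ultimately have "for_generic (\<lambda>p. rank (?R p0) \<le> rank (edge_operator E A p ** ?R p))"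
    by simp
  \<comment> \<open>the maximality of the rank at \<open>p0\<close> turns this fixed bound into one by the rank of \<open>R\<close> at \<open>p\<close> itself\<close>
  then have "admissible TYPE('d) E A"
    unfolding admissible_def
  proof (rule for_generic_mono)
    fix p :: "real ^ 'd ^ 'n"
    assume "rank (?R p0) \<le> rank (edge_operator E A p ** ?R p)"
    with p0[of p] have "rank (?R p) \<le> rank (edge_operator E A p ** ?R p)"
      by simp
    moreover have "edge_operator E A p *v x \<in> range ((*v) (?R p))" for x
    proof -
      have "edge_operator E A p *v x = ?R p *v (2 *\<^sub>R (transpose (directed_rigidity_matrix E A p) *v x))"
        by (simp add: edge_operator_def matrix_vector_mult_scaleR matrix_vector_mul_assoc
            del: transpose_matrix_vector flip: scaleR_matrix_vector_assoc)
      then show ?thesis by simp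
    qed
    ultimately show "bij_betw ((*v) (edge_operator E A p)) (range ((*v) (?R p))) (range ((*v) (?R p)))"
      unfolding rank_mult by (intro bij_betw_subspace sub) (auto simp: rank_dim_range)
  qed
  with A(1) show ?thesis
    by blast
qed

end
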